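(* For the cycle of $n>1$ nodes, i.e. for the contact rate matrix $Q$ on $V=\{1,\dots,n\}$ with $q_{i,i+1}=q_{i+1,i}=1$ for $i=1,\dots,n-1$, $q_{1,n}=q_{n,1}=1$ and all other entries $0$, and for $\alpha\in(1/2,1)$ with $\alpha n$ an integer, $$\delta(Q,\alpha)=2\left(1-\cos\left(\frac{\pi}{2(1-\alpha)n+1}\right)\right),$$ and, for fixed $\alpha$, as $n\to\infty$ (along $n$ with $\alpha n$ an integer) this equals $$\frac{\pi^2}{4(1-\alpha)^2n^2}(1+o(1)).$$
   Context: For a symmetric matrix $Q=(q_{i,j})_{i,j\in V}$ with non-negative entries and zero diagonal and a non-empty $S\subset V$, let $S^c=V\setminus S$ and let $Q_S=(q^S_{i,j})_{i,j\in V}$ be the matrix with $q^S_{i,i}=-\sum_{l\in V}q_{i,l}$ for all $i\in V$; $q^S_{i,j}=q_{i,j}$ for $i\in S^c$, $j\neq i$; and $q^S_{i,j}=0$ for $i\in S$, $j\neq i$. Its eigenvalues are real; let $\lambda_{Q_S}$ be the largest one. With $n=|V|$, define $$\delta(Q,\alpha)=\min_{S\subset V,\ |S|/n\in[2\alpha-1,\alpha]}|\lambda_{Q_S}|=\min_{S\subset V,\ |S|=(2\alpha-1)n}|\lambda_{Q_S}|.$$ *)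

theory Defs
  imports
    "Jordan_Normal_Form.Spectral_Radius"
    "HOL-Library.Landau_Symbols"
begin

text \<open>
  The node set is \<open>V = {0..<n}\<close>, where \<open>n\<close> is the dimension of the rate matrix. Node \<open>i\<close> here
  is the node numbered \<open>i + 1\<close> when \<open>V = {1, \<dots>, n}\<close>.
\<close>

definition restricted_rates :: "real mat \<Rightarrow> nat set \<Rightarrow> real mat" where
  "restricted_rates Q S = mat (dim_row Q) (dim_row Q) (\<lambda>(i, j).
     if i = j then - (\<Sum>l<dim_row Q. Q $$ (i, l))
     else if i \<in> S then 0
     else Q $$ (i, j))"

text \<open>
  The spectrum of a real matrix consists of its real eigenvalues only. For \<open>restricted_rates Q S\<close>
  with \<open>Q\<close> symmetric these are all the complex eigenvalues, and there is at least one;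
  see \<open>eigenvalue_restricted_rates_real\<close> and \<open>spectrum_restricted_rates\<close> below.
\<close>

definition largest_eigenvalue :: "real mat \<Rightarrow> real" where
  "largest_eigenvalue A = Max (spectrum A)"

definition delta :: "real mat \<Rightarrow> real \<Rightarrow> real" where
  "delta Q \<alpha> =
     Min ((\<lambda>S. \<bar>largest_eigenvalue (restricted_rates Q S)\<bar>) `
       {S. S \<subseteq> {0..<dim_row Q} \<and> real (card S) / real (dim_row Q) \<in> {2 * \<alpha> - 1..\<alpha>}})"

definition cycle_rates :: "nat \<Rightarrow> real mat" where
  "cycle_rates n = mat n n (\<lambda>(i, j).
     if j = i + 1 \<or> i = j + 1 \<or> (i = 0 \<and> j = n - 1) \<or> (i = n - 1 \<and> j = 0) then 1 else 0)"

lemma restricted_rates_carrier: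
  "Q \<in> carrier_mat n n \<Longrightarrow> restricted_rates Q S \<in> carrier_mat n n"
  by (simp add: restricted_rates_def)

lemma eigenvalue_restricted_rates_real:
  assumes Q: "Q \<in> carrier_mat n n"
    and sym: "\<And>i j. i < n \<Longrightarrow> j < n \<Longrightarrow> Q $$ (i, j) = Q $$ (j, i)"
    and ev: "eigenvalue (map_mat complex_of_real (restricted_rates Q S)) k"
  shows "k \<in> \<real>"
proof -
  define R where "R = restricted_rates Q S"
  have R: "R \<in> carrier_mat n n"
    using restricted_rates_carrier[OF Q] by (simp add: R_def)
  define a where "a i j = complex_of_real (R $$ (i, j))" for i j
  have a_sym: "a i j = a j i" if "i < n" "j < n" "i \<notin> S" "j \<notin> S" for i j
    using that Q sym by (auto simp: a_def R_def restricted_rates_def)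
  have a_zero: "a i j = 0" if "i < n" "j < n" "i \<in> S" "i \<noteq> j" for i j
    using that Q by (auto simp: a_def R_def restricted_rates_def)
  obtain v where v: "v \<in> carrier_vec n" "v \<noteq> 0\<^sub>v n"
    and Av: "map_mat complex_of_real R *\<^sub>v v = k \<cdot>\<^sub>v v"
    using ev R unfolding eigenvalue_def eigenvector_def R_def[symmetric] by auto
  have row: "(\<Sum>j<n. a i j * v $ j) = k * v $ i" if i: "i < n" for i
  proof -
    have "(map_mat complex_of_real R *\<^sub>v v) $ i = (\<Sum>j<n. a i j * v $ j)"
      using i R v by (auto simp: scalar_prod_def a_def lessThan_atLeast0 intro!: sum.cong)
    then show ?thesis
      using Av i v by simp
  qed
  show ?thesis
  proof (cases "\<exists>i<n. i \<in> S \<and> v $ i \<noteq> 0")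
    case True
    then obtain i where i: "i < n" "i \<in> S" "v $ i \<noteq> 0" by blast
    have "(\<Sum>j<n. a i j * v $ j) = (\<Sum>j<n. if j = i then a i i * v $ i else 0)"
      using i a_zero by (intro sum.cong) auto
    also have "\<dots> = a i i * v $ i"
      using i by simp
    finally have "k = a i i"
      using row[OF i(1)] i(3) by simp
    then show ?thesis
      by (simp add: a_def)
  next
    case False
    then have v_zero: "v $ i = 0" if "i < n" "i \<in> S" for i
      using that by blast
    define X where "X = (\<Sum>i<n. \<Sum>j<n. cnj (v $ i) * a i j * v $ j)"
    define N where "N = (\<Sum>i<n. (cmod (v $ i))\<^sup>2)"
    have nrm: "cnj z * z = complex_of_real ((cmod z)\<^sup>2)" for z
      by (metis complex_norm_square mult.commute)
    have "X = (\<Sum>i<n. cnj (v $ i) * (\<Sum>j<n. a i j * v $ j))"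
      by (simp add: X_def sum_distrib_left mult.assoc)
    also have "\<dots> = (\<Sum>i<n. k * complex_of_real ((cmod (v $ i))\<^sup>2))"
      by (intro sum.cong) (simp_all add: row nrm[symmetric] del: of_real_power)
    also have "\<dots> = k * complex_of_real N"
      by (simp add: N_def sum_distrib_left)
    finally have XN: "X = k * complex_of_real N" .
    have "cnj X = (\<Sum>i<n. \<Sum>j<n. v $ i * a i j * cnj (v $ j))"
      by (simp add: X_def a_def)
    also have "\<dots> = (\<Sum>j<n. \<Sum>i<n. v $ i * a i j * cnj (v $ j))"
      by (rule sum.swap)
    also have "\<dots> = X"
      unfolding X_def
    proof (intro sum.cong refl)
      fix i j assume "i \<in> {..<n}" "j \<in> {..<n}"
      then show "v $ j * a j i * cnj (v $ i) = cnj (v $ i) * a i j * v $ j"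
        using a_sym[of i j] v_zero[of i] v_zero[of j] by (cases "i \<in> S \<or> j \<in> S") auto
    qed
    finally have "X \<in> \<real>"
      by (simp add: Reals_cnj_iff)
    have "\<exists>i<n. v $ i \<noteq> 0"
      using v by (metis carrier_vecD eq_vecI index_zero_vec(1) index_zero_vec(2))
    then have "N \<noteq> 0"
      by (auto simp: N_def sum_nonneg_eq_0_iff)
    then have "k = X / complex_of_real N"
      using XN by simp
    then show ?thesis
      using \<open>X \<in> \<real>\<close> by simp
  qed
qed

lemma spectrum_restricted_rates:
  assumes Q: "Q \<in> carrier_mat n n" and n: "n > 0"
    and sym: "\<And>i j. i < n \<Longrightarrow> j < n \<Longrightarrow> Q $$ (i, j) = Q $$ (j, i)"
  shows "spectrum (map_mat complex_of_real (restricted_rates Q S)) =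
           complex_of_real ` spectrum (restricted_rates Q S)"
    and "finite (spectrum (restricted_rates Q S))"
    and "spectrum (restricted_rates Q S) \<noteq> {}"
proof -
  define R where "R = restricted_rates Q S"
  have R: "R \<in> carrier_mat n n"
    using restricted_rates_carrier[OF Q] by (simp add: R_def)
  have C: "map_mat complex_of_real R \<in> carrier_mat n n"
    using R by simp
  have iff: "complex_of_real x \<in> spectrum (map_mat complex_of_real R) \<longleftrightarrow> x \<in> spectrum R" for x
    by (simp add: spectrum_root_char_poly[OF R] spectrum_root_char_poly[OF C]
        of_real_hom.char_poly_hom[OF R])
  have "k \<in> \<real>" if "k \<in> spectrum (map_mat complex_of_real R)" for k
    using that eigenvalue_restricted_rates_real[OF Q sym, of S k]
    by (auto simp: spectrum_def R_def)
  then show eq: "spectrum (map_mat complex_of_real (restricted_rates Q S)) =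
      complex_of_real ` spectrum (restricted_rates Q S)"
    unfolding R_def[symmetric] using iff by (auto elim!: Reals_cases)
  show "finite (spectrum (restricted_rates Q S))"
    using card_finite_spectrum[OF R] by (simp add: R_def)
  show "spectrum (restricted_rates Q S) \<noteq> {}"
    using spectrum_non_empty[OF C n] eq by (auto simp: R_def)
qed

end

theory Submission
  imports Defs "HOL-Real_Asymp.Real_Asymp"
begin

text \<open>
  A row of \<open>Q\<^sub>S\<close> indexed by a vertex of \<open>S\<close> has the diagonal entry \<open>-2\<close> and is zero elsewhere, so
  the spectrum of \<open>Q\<^sub>S\<close> is \<open>-2\<close> together with that of the discrete Laplacian on the arcs of \<open>S\<^sup>c\<close>
  with zero boundary values. An arc with \<open>l\<close> vertices has largest Dirichlet eigenvalue
  \<open>2 * cos (\<pi> / (l + 1)) - 2\<close>, which increases with \<open>l\<close>; the least \<open>\<bar>\<lambda>\<bar>\<close> is therefore reached when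
  \<open>S\<^sup>c\<close> is a single arc of the greatest size that the constraint allows, \<open>L = 2 * (1 - \<alpha>) * n\<close>.

  The proof avoids decomposing \<open>S\<^sup>c\<close> into arcs and diagonalizing each. For an arbitrary \<open>S\<close> the upper
  bound on the spectrum comes from a comparison principle (\<open>eigenvalue_restricted_rates_le\<close>): a
  non-negative function \<open>w\<close>, positive off \<open>S\<close>, with \<open>Q\<^sub>S w \<le> \<mu> w\<close> off \<open>S\<close> forces every eigenvalue to
  be at most \<open>\<mu>\<close>, provided that \<open>-2 \<le> \<mu>\<close>. With \<open>\<theta> = \<pi> / (L + 1)\<close>, the function
  \<open>w i = sin (d i * \<theta>)\<close> serves, where \<open>d i\<close> is the number of forward steps from \<open>i\<close> to \<open>S\<close>: it
  follows the first sine mode of an arc of \<open>L\<close> vertices, cut off early on shorter arcs, and cutting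
  off only decreases the neighbour sum. The inequality \<open>d i \<le> \<bar>S\<^sup>c\<bar> \<le> L\<close> (\<open>steps_to_le\<close>) keeps the
  sine positive off \<open>S\<close>. When \<open>S\<^sup>c\<close> is an arc of \<open>L\<close> vertices the sine mode is a true eigenvector
  (\<open>eigenvalue_restricted_cycle_path\<close>), so the bound is attained. The asymptotics follow from
  \<open>2 * (1 - cos x) \<sim> x\<^sup>2\<close> at \<open>0\<close>.
\<close>

section \<open>A comparison principle for restricted rate matrices\<close>

lemma restricted_rates_mult_vec_index:
  assumes Q: "Q \<in> carrier_mat n n" and x: "x \<in> carrier_vec n" and i: "i < n"
    and diag: "Q $$ (i, i) = 0"
  shows "(restricted_rates Q S *\<^sub>v x) $ i =
    (if i \<in> S then 0 else \<Sum>j<n. Q $$ (i, j) * x $ j) - (\<Sum>l<n. Q $$ (i, l)) * x $ i"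
proof -
  let ?r = "\<Sum>l<n. Q $$ (i, l)"
  have "(restricted_rates Q S *\<^sub>v x) $ i = (\<Sum>j<n. restricted_rates Q S $$ (i, j) * x $ j)"
    using i Q x by (auto simp: restricted_rates_def scalar_prod_def lessThan_atLeast0 intro!: sum.cong)
  also have "\<dots> = (\<Sum>j<n. (if i \<in> S then 0 else Q $$ (i, j) * x $ j)
      - (if j = i then ?r * x $ i else 0))"
    using i Q diag by (intro sum.cong) (auto simp: restricted_rates_def)
  finally show ?thesis
    using i by (simp add: sum_subtractf)
qed

text \<open>
  An eigenvector that is nonzero somewhere on \<open>S\<close> has minus a row sum as its eigenvalue, which
  \<open>absorbed\<close> controls. Any other eigenvector \<open>x\<close> vanishes on \<open>S\<close>; scale \<open>w\<close> by the least \<open>t\<close>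
  with \<open>\<bar>x\<bar> \<le> t * w\<close>. At a vertex outside \<open>S\<close> where the two sides touch, the eigenvalue equation
  for \<open>x\<close> and the supersolution inequality for \<open>w\<close> compare \<open>\<kappa>\<close> with \<open>\<mu>\<close> directly.
\<close>

lemma eigenvalue_restricted_rates_le:
  assumes Q: "Q \<in> carrier_mat n n"
    and diag: "\<And>i. i < n \<Longrightarrow> Q $$ (i, i) = 0"
    and nonneg: "\<And>i j. i < n \<Longrightarrow> j < n \<Longrightarrow> 0 \<le> Q $$ (i, j)"
    and w_nonneg: "\<And>i. i < n \<Longrightarrow> 0 \<le> w i"
    and w_pos: "\<And>i. i < n \<Longrightarrow> i \<notin> S \<Longrightarrow> 0 < w i"
    and super: "\<And>i. i < n \<Longrightarrow> i \<notin> S \<Longrightarrow>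
      (\<Sum>j<n. Q $$ (i, j) * w j) \<le> (\<mu> + (\<Sum>l<n. Q $$ (i, l))) * w i"
    and absorbed: "\<And>i. i < n \<Longrightarrow> i \<in> S \<Longrightarrow> - (\<Sum>l<n. Q $$ (i, l)) \<le> \<mu>"
    and ev: "eigenvalue (restricted_rates Q S) \<kappa>"
  shows "\<kappa> \<le> \<mu>"
proof -
  define r where "r i = (\<Sum>l<n. Q $$ (i, l))" for i
  obtain x where x: "x \<in> carrier_vec n" "x \<noteq> 0\<^sub>v n"
    and Rx: "restricted_rates Q S *\<^sub>v x = \<kappa> \<cdot>\<^sub>v x"
    using ev restricted_rates_carrier[OF Q, of S] unfolding eigenvalue_def eigenvector_def by auto
  have row: "\<kappa> * x $ i = (if i \<in> S then 0 else \<Sum>j<n. Q $$ (i, j) * x $ j) - r i * x $ i"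
    if "i < n" for i
    using restricted_rates_mult_vec_index[OF Q x(1) that diag[OF that], of S] Rx x that
    by (simp add: r_def)
  show ?thesis
  proof (cases "\<exists>i<n. i \<in> S \<and> x $ i \<noteq> 0")
    case True
    then obtain i where i: "i < n" "i \<in> S" "x $ i \<noteq> 0" by blast
    have "\<kappa> * x $ i = (- r i) * x $ i"
      using row[OF i(1)] i(2) by simp
    then have "\<kappa> = - r i"
      using i(3) by (simp only: mult_cancel_right) simp
    then show ?thesis
      using absorbed[OF i(1,2)] by (simp add: r_def)
  next
    case False
    then have x_zero: "x $ i = 0" if "i < n" "i \<in> S" for i
      using that by blast
    define U where "U = {..<n} - S"
    obtain p where p: "p < n" "x $ p \<noteq> 0"
      using x by (metis carrier_vecD eq_vecI index_zero_vec(1) index_zero_vec(2))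
    then have pU: "p \<in> U"
      using x_zero by (auto simp: U_def)
    define t where "t = Max ((\<lambda>i. \<bar>x $ i\<bar> / w i) ` U)"
    have "t \<in> (\<lambda>i. \<bar>x $ i\<bar> / w i) ` U"
      unfolding t_def using pU by (intro Max_in) (auto simp: U_def)
    then obtain i where i: "i < n" "i \<notin> S" and t: "t = \<bar>x $ i\<bar> / w i"
      by (auto simp: U_def)
    have t_ge: "\<bar>x $ j\<bar> / w j \<le> t" if "j \<in> U" for j
      unfolding t_def using that by (intro Max_ge) (auto simp: U_def)
    have "0 < \<bar>x $ p\<bar> / w p"
      using p pU w_pos[of p] by (simp add: U_def)
    with t_ge[OF pU] have t_pos: "0 < t" by linarith
    have dominated: "\<bar>x $ j\<bar> \<le> t * w j" if "j < n" for j
    proof (cases "j \<in> S")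
      case True
      then show ?thesis
        using that x_zero w_nonneg t_pos by simp
    next
      case False
      then show ?thesis
        using that t_ge[of j] w_pos[of j] by (simp add: U_def field_simps)
    qed
    have xi: "\<bar>x $ i\<bar> = t * w i"
      using t w_pos[OF i] by simp
    have "(\<kappa> + r i) * \<bar>x $ i\<bar> \<le> \<bar>(\<kappa> + r i) * x $ i\<bar>"
      by (simp add: abs_mult mult_right_mono)
    also have "(\<kappa> + r i) * x $ i = (\<Sum>j<n. Q $$ (i, j) * x $ j)"
      using row[OF i(1)] i(2) by (simp add: algebra_simps)
    also have "\<bar>\<dots>\<bar> \<le> (\<Sum>j<n. Q $$ (i, j) * \<bar>x $ j\<bar>)"
      using nonneg[OF i(1)] by (intro order_trans[OF sum_abs] sum_mono) (simp add: abs_mult)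
    also have "\<dots> \<le> (\<Sum>j<n. Q $$ (i, j) * (t * w j))"
      using nonneg[OF i(1)] dominated by (intro sum_mono mult_left_mono) auto
    also have "\<dots> = t * (\<Sum>j<n. Q $$ (i, j) * w j)"
      by (simp add: sum_distrib_left mult_ac)
    also have "\<dots> \<le> t * ((\<mu> + r i) * w i)"
      using super[OF i] t_pos by (intro mult_left_mono) (auto simp: r_def)
    also have "\<dots> = (\<mu> + r i) * \<bar>x $ i\<bar>"
      by (simp add: xi)
    finally show ?thesis
      using xi t_pos w_pos[OF i] by simp
  qed
qed

section \<open>The cycle and the forward distance to a set of its vertices\<close>

lemma cycle_rates_carrier: "cycle_rates n \<in> carrier_mat n n"
  by (simp add: cycle_rates_def)

lemma cycle_rates_sym:
  "i < n \<Longrightarrow> j < n \<Longrightarrow> cycle_rates n $$ (i, j) = cycle_rates n $$ (j, i)"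
  by (auto simp: cycle_rates_def)

lemma cycle_rates_nonneg: "i < n \<Longrightarrow> j < n \<Longrightarrow> 0 \<le> cycle_rates n $$ (i, j)"
  by (simp add: cycle_rates_def)

lemma cycle_rates_diag: "n > 1 \<Longrightarrow> i < n \<Longrightarrow> cycle_rates n $$ (i, i) = 0"
  by (auto simp: cycle_rates_def)

text \<open>
  On two vertices the successor and the predecessor of a vertex coincide but their common entry
  is still \<open>1\<close>, hence \<open>n > 2\<close>. The predecessor is written \<open>i + n - 1\<close> because subtraction is
  truncated at \<open>0\<close>.
\<close>

lemma sum_cycle_rates:
  assumes n: "n > 2" and i: "i < n"
  shows "(\<Sum>j<n. cycle_rates n $$ (i, j) * f j) = f (Suc i mod n) + f ((i + n - 1) mod n)"
proof -
  have s: "Suc i mod n = (if i = n - 1 then 0 else Suc i)"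
    using assms by auto
  have p: "(i + n - 1) mod n = (if i = 0 then n - 1 else i - 1)"
  proof (cases i)
    case (Suc k)
    then have "i + n - 1 = k + n" by simp
    then show ?thesis using Suc i by simp
  qed (use n in simp)
  have "(\<Sum>j<n. cycle_rates n $$ (i, j) * f j) =
      (\<Sum>j<n. (if j = Suc i mod n then f j else 0) + (if j = (i + n - 1) mod n then f j else 0))"
    unfolding s p using assms by (intro sum.cong) (auto simp: cycle_rates_def)
  also have "\<dots> = f (Suc i mod n) + f ((i + n - 1) mod n)"
    using n by (simp add: sum.distrib)
  finally show ?thesis .
qed

lemma sum_cycle_rates_row:
  "n > 2 \<Longrightarrow> i < n \<Longrightarrow> (\<Sum>j<n. cycle_rates n $$ (i, j)) = 2"
  using sum_cycle_rates[of n i "\<lambda>_. 1"] by simp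

text \<open>
  Vertices are natural numbers read modulo \<open>n\<close>, so that going round the cycle is plain addition.
  Counting in one direction only gives a value that changes by exactly one along an arc.
\<close>

definition steps_to :: "nat \<Rightarrow> nat set \<Rightarrow> nat \<Rightarrow> nat" where
  "steps_to n S i = (LEAST d. (i + d) mod n \<in> S)"

lemma steps_to_eq_0: "i mod n \<in> S \<Longrightarrow> steps_to n S i = 0"
  unfolding steps_to_def by (rule Least_equality) auto

lemma steps_to_mod: "steps_to n S (i mod n) = steps_to n S i"
  by (simp add: steps_to_def mod_add_left_eq)

context
  fixes n :: nat and S :: "nat set"
  assumes S: "S \<subseteq> {0..<n}" "S \<noteq> {}"
begin

lemma ex_steps_to: "\<exists>d. (i + d) mod n \<in> S"
proof -
  obtain s where s: "s \<in> S" "s < n"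
    using S by force
  have "(i + (s + (n - i mod n))) mod n = s"
  proof -
    have "(i + (s + (n - i mod n))) mod n = (i mod n + (s + (n - i mod n))) mod n"
      by (simp add: mod_add_left_eq)
    also have "i mod n + (s + (n - i mod n)) = s + n"
      using s(2) mod_less_divisor[of n i] by linarith
    finally show ?thesis
      using s(2) by simp
  qed
  then show ?thesis
    using s(1) by metis
qed

lemma steps_to_Suc:
  assumes "i mod n \<notin> S"
  shows "steps_to n S i = Suc (steps_to n S (Suc i))"
proof -
  obtain d where "(i + d) mod n \<in> S"
    using ex_steps_to by blast
  from Least_Suc[of "\<lambda>d. (i + d) mod n \<in> S", OF this] show ?thesis
    using assms by (simp add: steps_to_def)
qed

text \<open>The walk from \<open>i\<close> to its first visit to \<open>S\<close> passes through pairwise distinct vertices of \<open>S\<^sup>c\<close>.\<close>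

lemma steps_to_le: "steps_to n S i \<le> n - card S"
proof -
  let ?d = "steps_to n S i"
  have n: "n > 0" using S by auto
  have notin: "(i + e) mod n \<notin> S" if "e < ?d" for e
    using that not_less_Least unfolding steps_to_def by blast
  have "inj_on (\<lambda>e. (i + e) mod n) {..<?d}"
  proof (rule linorder_inj_onI')
    fix a b assume ab: "a \<in> {..<?d}" "b \<in> {..<?d}" "a < b"
    show "(i + a) mod n \<noteq> (i + b) mod n"
    proof
      assume eq: "(i + a) mod n = (i + b) mod n"
      \<comment> \<open>A repeated vertex would bring the first visit to \<open>S\<close> forward by \<open>b - a\<close> steps.\<close>
      have "(i + (?d - (b - a))) mod n = ((i + a) + (?d - b)) mod n"
        using ab by (intro arg_cong[where f = "\<lambda>k. k mod n"]) auto
      also have "\<dots> = ((i + b) + (?d - b)) mod n"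
        using eq by (metis mod_add_left_eq)
      also have "(i + b) + (?d - b) = i + ?d"
        using ab by auto
      also have "(i + ?d) mod n \<in> S"
        using ex_steps_to[of i] unfolding steps_to_def by (rule LeastI_ex)
      finally have "(i + (?d - (b - a))) mod n \<in> S" .
      moreover have "?d - (b - a) < ?d"
        using ab by auto
      ultimately show False
        using notin by blast
    qed
  qed
  then have "?d = card ((\<lambda>e. (i + e) mod n) ` {..<?d})"
    by (simp add: card_image)
  also have "\<dots> \<le> card ({0..<n} - S)"
    using notin n by (intro card_mono) auto
  also have "\<dots> = n - card S"
    using S by (simp add: card_Diff_subset finite_subset)
  finally show ?thesis .
qed

end

section \<open>The largest eigenvalue of a restricted cycle\<close>

text \<open>
  The supersolution is \<open>w i = sin (d i * \<theta>)\<close> with \<open>d = steps_to n S\<close>. At a vertex \<open>i\<close> outside \<open>S\<close>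
  the successor has distance \<open>d i - 1\<close>, and the predecessor has distance \<open>d i + 1\<close> or lies in \<open>S\<close>.
  In the latter case \<open>w\<close> is \<open>0\<close> there, which is at most \<open>sin ((d i + 1) * \<theta>)\<close> since
  \<open>(d i + 1) * \<theta> \<le> \<pi>\<close>. So the neighbour sum is at most \<open>2 * cos \<theta> * w i\<close>.
\<close>

lemma eigenvalue_restricted_cycle_le:
  assumes n: "n > 2" and S: "S \<subseteq> {0..<n}" and L: "0 < L" "L < n" and card: "n - L \<le> card S"
    and ev: "eigenvalue (restricted_rates (cycle_rates n) S) \<kappa>"
  shows "\<kappa> \<le> 2 * cos (pi / (real L + 1)) - 2"
proof -
  define \<theta> where "\<theta> = pi / (real L + 1)"
  define w where "w i = sin (real (steps_to n S i) * \<theta>)" for i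
  have ne: "S \<noteq> {}"
    using card L by auto
  have \<theta>: "0 < \<theta>" "(real L + 1) * \<theta> = pi"
    by (auto simp: \<theta>_def add_pos_pos)
  have "2 * \<theta> \<le> (real L + 1) * \<theta>"
    using L(1) \<theta>(1) by (intro mult_right_mono) auto
  \<comment> \<open>This puts the eigenvalue \<open>-2\<close> carried by the vertices of \<open>S\<close> below the bound.\<close>
  then have cos_nonneg: "0 \<le> cos \<theta>"
    using \<theta> by (intro cos_ge_zero) auto
  have d_le: "steps_to n S i \<le> L" for i
    using steps_to_le[OF S ne, of i] card by linarith
  have sin_nonneg: "0 \<le> sin (real d * \<theta>)" if "d \<le> Suc L" for d
  proof (rule sin_ge_zero)
    have "real d * \<theta> \<le> (real L + 1) * \<theta>"
      using that \<theta>(1) by (intro mult_right_mono) auto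
    then show "real d * \<theta> \<le> pi"
      using \<theta>(2) by simp
  qed (use \<theta> in simp)
  have w_mod: "w (i mod n) = w i" for i
    by (simp add: w_def steps_to_mod)
  show ?thesis
    unfolding \<theta>_def[symmetric]
  proof (rule eigenvalue_restricted_rates_le[where w = w, OF cycle_rates_carrier _ _ _ _ _ _ ev])
    fix i assume i: "i < n"
    show "cycle_rates n $$ (i, i) = 0"
      using n i by (intro cycle_rates_diag) auto
    show "0 \<le> cycle_rates n $$ (i, j)" if "j < n" for j
      using i that by (rule cycle_rates_nonneg)
    show "0 \<le> w i"
      unfolding w_def using d_le[of i] by (intro sin_nonneg) simp
    show "- (\<Sum>l<n. cycle_rates n $$ (i, l)) \<le> 2 * cos \<theta> - 2"
      using cos_nonneg sum_cycle_rates_row[OF n i] by simp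
    assume iS: "i \<notin> S"
    define d where "d = steps_to n S i"
    have d_Suc: "d = Suc (steps_to n S (Suc i))"
      unfolding d_def using i iS by (intro steps_to_Suc[OF S ne]) simp
    have "d \<le> L"
      unfolding d_def by (rule d_le)
    then have "real d * \<theta> < (real L + 1) * \<theta>"
      using \<theta>(1) by (intro mult_strict_right_mono) auto
    then show "0 < w i"
      unfolding w_def d_def[symmetric] using d_Suc \<theta> by (intro sin_gt_zero) auto
    have next_val: "w (Suc i) = sin ((real d - 1) * \<theta>)"
      by (simp add: w_def d_Suc)
    have pred_val: "w (i + n - 1) \<le> sin ((real d + 1) * \<theta>)"
    proof (cases "(i + n - 1) mod n \<in> S")
      case True
      then show ?thesis
        using sin_nonneg[of "Suc d"] \<open>d \<le> L\<close> by (simp add: w_def steps_to_eq_0 algebra_simps)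
    next
      case False
      have "steps_to n S (Suc (i + n - 1)) = d"
        using i n steps_to_mod[of n S "i + n"] by (simp add: d_def)
      then show ?thesis
        using steps_to_Suc[OF S ne False] by (simp add: w_def algebra_simps)
    qed
    have "(\<Sum>j<n. cycle_rates n $$ (i, j) * w j) = w (Suc i) + w (i + n - 1)"
      using sum_cycle_rates[OF n i, of w] by (simp only: w_mod)
    also have "\<dots> \<le> sin ((real d - 1) * \<theta>) + sin ((real d + 1) * \<theta>)"
      using next_val pred_val by simp
    also have "\<dots> = 2 * cos \<theta> * sin (real d * \<theta>)"
      by (simp add: ring_distribs sin_add sin_diff)
    also have "\<dots> = (2 * cos \<theta> - 2 + (\<Sum>l<n. cycle_rates n $$ (i, l))) * w i"
      using sum_cycle_rates_row[OF n i] by (simp add: w_def d_def)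
    finally show "(\<Sum>j<n. cycle_rates n $$ (i, j) * w j)
        \<le> (2 * cos \<theta> - 2 + (\<Sum>l<n. cycle_rates n $$ (i, l))) * w i" .
  qed
qed

text \<open>
  The eigenvector is the first sine mode of the path \<open>0, \<dots>, L - 1\<close>, extended by zero. The sine
  vanishes at the two neighbours of the path, at angles \<open>0\<close> and \<open>(L + 1) * \<theta> = \<pi>\<close>, so the recurrence
  holds at the end vertices as it does inside.
\<close>

lemma eigenvalue_restricted_cycle_path:
  assumes n: "n > 2" and L: "0 < L" "L < n"
  shows "eigenvalue (restricted_rates (cycle_rates n) {L..<n}) (2 * cos (pi / (real L + 1)) - 2)"
proof -
  define \<theta> where "\<theta> = pi / (real L + 1)"
  define w where "w i = (if i < L then sin ((real i + 1) * \<theta>) else 0)" for i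
  define R where "R = restricted_rates (cycle_rates n) {L..<n}"
  have R: "R \<in> carrier_mat n n"
    unfolding R_def by (rule restricted_rates_carrier[OF cycle_rates_carrier])
  have \<theta>: "0 < \<theta>" "(real L + 1) * \<theta> = pi"
    by (auto simp: \<theta>_def add_pos_pos)
  have "\<theta> < (real L + 1) * \<theta>"
    using L(1) \<theta>(1) by simp
  then have "0 < sin \<theta>"
    using \<theta> by (intro sin_gt_zero) auto
  then have "vec n w $ 0 \<noteq> 0\<^sub>v n $ 0"
    using L by (simp add: w_def)
  then have ne: "vec n w \<noteq> 0\<^sub>v n"
    by metis
  have "R *\<^sub>v vec n w = (2 * cos \<theta> - 2) \<cdot>\<^sub>v vec n w"
  proof (rule eq_vecI)
    fix i assume "i < dim_vec ((2 * cos \<theta> - 2) \<cdot>\<^sub>v vec n w)"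
    then have i: "i < n" by simp
    have row: "(R *\<^sub>v vec n w) $ i = (if i \<in> {L..<n} then 0 else
        (\<Sum>j<n. cycle_rates n $$ (i, j) * w j)) - 2 * w i"
      unfolding R_def using n i
      by (subst restricted_rates_mult_vec_index[OF cycle_rates_carrier _ i cycle_rates_diag])
        (auto simp: sum_cycle_rates_row intro!: sum.cong)
    show "(R *\<^sub>v vec n w) $ i = ((2 * cos \<theta> - 2) \<cdot>\<^sub>v vec n w) $ i"
    proof (cases "i < L")
      case True
      have succ: "w (Suc i mod n) = sin ((real i + 2) * \<theta>)"
      proof (cases "Suc i = L")
        case True
        then have "(real i + 2) * \<theta> = pi"
          using \<theta>(2) by (simp add: algebra_simps flip: True)
        then show ?thesis
          using True L by (simp add: w_def)
      qed (use \<open>i < L\<close> L in \<open>simp add: w_def algebra_simps\<close>)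
      have pred: "w ((i + n - 1) mod n) = sin (real i * \<theta>)"
      proof (cases i)
        case (Suc k)
        then have "i + n - 1 = k + n" by simp
        then show ?thesis
          using Suc i True by (simp add: w_def algebra_simps)
      qed (use L in \<open>simp add: w_def\<close>)
      have "sin ((real i + 2) * \<theta>) + sin (real i * \<theta>)
          = sin ((real i + 1) * \<theta> + \<theta>) + sin ((real i + 1) * \<theta> - \<theta>)"
        by (simp add: algebra_simps)
      also have "\<dots> = 2 * cos \<theta> * sin ((real i + 1) * \<theta>)"
        unfolding sin_add sin_diff by simp
      finally have "(\<Sum>j<n. cycle_rates n $$ (i, j) * w j) = 2 * cos \<theta> * w i"
        using True unfolding sum_cycle_rates[OF n i] succ pred by (simp add: w_def)
      then show ?thesis
        using row True i by (simp add: algebra_simps)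
    next
      case False
      then show ?thesis
        using row i by (simp add: w_def)
    qed
  qed (use R in simp)
  then show ?thesis
    using R ne unfolding eigenvalue_def eigenvector_def R_def \<theta>_def by (intro exI[of _ "vec n w"]) auto
qed

section \<open>The minimum over restricting sets and its asymptotics\<close>

lemma delta_cycle_rates:
  assumes \<alpha>: "1 / 2 < \<alpha>" "\<alpha> < 1" and n: "n > 1" and int: "\<alpha> * real n \<in> \<int>"
  shows "delta (cycle_rates n) \<alpha> = 2 * (1 - cos (pi / (2 * (1 - \<alpha>) * real n + 1)))"
proof -
  define M where "M = {S. S \<subseteq> {0..<n} \<and> real (card S) / real n \<in> {2 * \<alpha> - 1..\<alpha>}}"
  have "\<alpha> * real n \<in> \<nat>"
    using int \<alpha> by (simp add: Nats_altdef2)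
  then obtain m where m: "\<alpha> * real n = real m"
    by (auto elim: Nats_cases)
  have "1 / 2 * real n < \<alpha> * real n" "\<alpha> * real n < 1 * real n"
    using \<alpha> n by (intro mult_strict_right_mono; simp)+
  then have mn: "n < 2 * m" "m < n"
    using m by linarith+
  \<comment> \<open>\<open>L\<close> is the size of \<open>S\<^sup>c\<close> for the smallest admissible \<open>S\<close>, of size \<open>(2 * \<alpha> - 1) * n\<close>.\<close>
  define L where "L = 2 * (n - m)"
  have n3: "n > 2" and L: "0 < L" "L < n"
    using mn by (auto simp: L_def)
  have rL: "real L = 2 * (1 - \<alpha>) * real n"
    using mn m by (simp add: L_def algebra_simps)
  define c where "c = 2 * cos (pi / (real L + 1)) - 2"
  have c_le: "c \<le> 0"
    by (simp add: c_def)
  have M_card: "n - L \<le> card S" if "S \<in> M" for S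
  proof -
    have "2 * \<alpha> - 1 \<le> real (card S) / real n"
      using that by (auto simp: M_def)
    then have "(2 * \<alpha> - 1) * real n \<le> real (card S)"
      using n by (simp add: field_simps)
    then have "real (n - L) \<le> real (card S)"
      using rL L by (simp add: algebra_simps)
    then show ?thesis
      by simp
  qed
  note spec = spectrum_restricted_rates[OF cycle_rates_carrier _ cycle_rates_sym, of n]
  have n0: "0 < n" using n by simp
  have upper: "\<kappa> \<le> c" if "S \<in> M" "\<kappa> \<in> spectrum (restricted_rates (cycle_rates n) S)" for S \<kappa>
    using that eigenvalue_restricted_cycle_le[OF n3 _ L M_card] unfolding c_def spectrum_def M_def
    by blast
  have le: "largest_eigenvalue (restricted_rates (cycle_rates n) S) \<le> c" if "S \<in> M" for S
    unfolding largest_eigenvalue_def using upper[OF that] spec(2,3)[OF n0] by (subst Max_le_iff) auto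
  have path: "{L..<n} \<in> M"
  proof -
    have "real (card {L..<n}) = (2 * \<alpha> - 1) * real n"
      using rL L by (simp add: algebra_simps)
    then have "real (card {L..<n}) / real n = 2 * \<alpha> - 1"
      using n by (simp add: field_simps)
    then show ?thesis
      using \<alpha> by (auto simp: M_def simp del: card_atLeastLessThan)
  qed
  have eq: "largest_eigenvalue (restricted_rates (cycle_rates n) {L..<n}) = c"
    unfolding largest_eigenvalue_def
    using upper[OF path] spec(2)[OF n0] eigenvalue_restricted_cycle_path[OF n3 L]
    by (intro Max_eqI) (auto simp: c_def spectrum_def)
  have "delta (cycle_rates n) \<alpha>
      = Min ((\<lambda>S. \<bar>largest_eigenvalue (restricted_rates (cycle_rates n) S)\<bar>) ` M)"
    using cycle_rates_carrier[of n] by (simp add: delta_def M_def)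
  also have "\<dots> = - c"
  proof (rule Min_eqI)
    show "finite ((\<lambda>S. \<bar>largest_eigenvalue (restricted_rates (cycle_rates n) S)\<bar>) ` M)"
      by (intro finite_imageI finite_subset[of M "Pow {0..<n}"]) (auto simp: M_def)
    show "- c \<le> y"
      if "y \<in> (\<lambda>S. \<bar>largest_eigenvalue (restricted_rates (cycle_rates n) S)\<bar>) ` M" for y
      using that le by fastforce
    show "- c \<in> (\<lambda>S. \<bar>largest_eigenvalue (restricted_rates (cycle_rates n) S)\<bar>) ` M"
      using path eq c_le by (intro image_eqI[of _ _ "{L..<n}"]) auto
  qed
  finally show ?thesis
    by (simp add: c_def rL)
qed

lemma one_minus_cos_asymp:
  fixes b :: real
  assumes "b > 0"
  shows "(\<lambda>n. 2 * (1 - cos (pi / (2 * b * real n + 1))))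
    \<sim>[sequentially] (\<lambda>n. pi\<^sup>2 / (4 * b\<^sup>2 * (real n)\<^sup>2))"
proof -
  have small: "filterlim (\<lambda>n. pi / (2 * b * real n + 1)) (at 0) sequentially"
    using assms by real_asymp
  have "(\<lambda>x. 2 * (1 - cos x)) \<sim>[at (0::real)] (\<lambda>x. x\<^sup>2)"
    by real_asymp
  from asymp_equiv_compose'[OF this small]
  have "(\<lambda>n. 2 * (1 - cos (pi / (2 * b * real n + 1))))
      \<sim>[sequentially] (\<lambda>n. (pi / (2 * b * real n + 1))\<^sup>2)" .
  also have "(\<lambda>n. pi / (2 * b * real n + 1)) \<sim>[sequentially] (\<lambda>n. pi / (2 * b * real n))"
    using assms by real_asymp
  then have "(\<lambda>n. (pi / (2 * b * real n + 1))\<^sup>2)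
      \<sim>[sequentially] (\<lambda>n. (pi / (2 * b * real n))\<^sup>2)"
    by (rule asymp_equiv_power)
  finally show ?thesis
    by (simp add: power_divide power_mult_distrib)
qed

theorem lemma4:
  fixes \<alpha> :: real
  assumes "1 / 2 < \<alpha>" and "\<alpha> < 1"
  shows "(\<forall>n>1. \<alpha> * real n \<in> \<int> \<longrightarrow>
            delta (cycle_rates n) \<alpha> = 2 * (1 - cos (pi / (2 * (1 - \<alpha>) * real n + 1)))) \<and>
         (\<lambda>n. delta (cycle_rates n) \<alpha>)
           \<sim>[inf sequentially (principal {n. \<alpha> * real n \<in> \<int>})]
         (\<lambda>n. pi\<^sup>2 / (4 * (1 - \<alpha>)\<^sup>2 * (real n)\<^sup>2))"
proof
  show formula: "\<forall>n>1. \<alpha> * real n \<in> \<int> \<longrightarrow>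
      delta (cycle_rates n) \<alpha> = 2 * (1 - cos (pi / (2 * (1 - \<alpha>) * real n + 1)))"
    using delta_cycle_rates[OF assms] by blast
  let ?F = "inf sequentially (principal {n. \<alpha> * real n \<in> \<int>})"
  have ev: "\<forall>\<^sub>F n in ?F.
      delta (cycle_rates n) \<alpha> = 2 * (1 - cos (pi / (2 * (1 - \<alpha>) * real n + 1)))"
    unfolding eventually_inf_principal using eventually_gt_at_top[of 1]
    by eventually_elim (use formula in auto)
  have "(\<lambda>n. 2 * (1 - cos (pi / (2 * (1 - \<alpha>) * real n + 1))))
      \<sim>[?F] (\<lambda>n. pi\<^sup>2 / (4 * (1 - \<alpha>)\<^sup>2 * (real n)\<^sup>2))"
    using one_minus_cos_asymp[of "1 - \<alpha>"] assms(2)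
    unfolding asymp_equiv_def by (auto intro: tendsto_mono[rotated])
  then show "(\<lambda>n. delta (cycle_rates n) \<alpha>)
      \<sim>[?F] (\<lambda>n. pi\<^sup>2 / (4 * (1 - \<alpha>)\<^sup>2 * (real n)\<^sup>2))"
    using asymp_equiv_cong[OF ev always_eventually] by blast
qed

end
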